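(* Algorithm 1 (reproduced in the context) outputs the optimal solution of the Internal Opinion Problem: given a social trust network $\mathcal{G}=(\mathcal{V},\mathcal{E})$, the internal opinion vector $\mathbf{s}$ and the budget amount $\mu$, find the modification $\Delta\mathbf{s}$ of internal opinions attaining $$\max_{\Delta\mathbf{s}}\ \vec{\mathbf{1}}^T(\bar{\mathbf{L}}+\mathbf{I})^{-1}(\mathbf{s}+\Delta\mathbf{s})\quad\text{s.t.}\quad -1\le s_i+\Delta s_i\le 1\ (i=1,2,\dots,|\mathcal{V}|),\qquad \lVert\Delta\mathbf{s}\rVert_1\le\mu .$$
   Context: A social trust network is a directed signed weighted graph $\mathcal{G}=(\mathcal{V},\mathcal{E})$ with weights $w_{ij}\in[-1,1]$ on edges $(i,j)\in\mathcal{E}$. The adjacency matrix $\mathbf{A}=(a_{ij})$ has $a_{ij}=w_{ij}$ if $(i,j)\in\mathcal{E}$ and $a_{ij}=0$ otherwise. $\mathbf{D}$ is the diagonal matrix with $d_{ii}=\sum_j|a_{ij}|$, and $\bar{\mathbf{L}}=\mathbf{D}-\mathbf{A}$ (the matrix $\bar{\mathbf{L}}+\mathbf{I}$ is invertible, $\mathbf{I}$ being the identity matrix). $\vec{\mathbf{1}}$ is the all-ones column vector. The internal opinion vector $\mathbf{s}$ has components $s_i\in[-1,1]$. The contribution index vector is $\mathbf{g}=(\vec{\mathbf{1}}^T(\bar{\mathbf{L}}+\mathbf{I})^{-1})^T$, with components $g_i$. Algorithm 1. Input: a social trust network $\mathcal{G}=(\mathcal{V},\mathcal{E})$, internal opinions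 $\mathbf{s}$, and budget $\mu$. Output: the modification $\Delta\mathbf{s}$. Initialize $\Delta\mathbf{s}$ to the null vector. While $\mu>0$, do the following: find the component $g_i$ with the largest absolute value; if $g_i=0$, break; set $sign=g_i/|g_i|$ and $cost=1-sign\cdot s_i$; if $cost>\mu$, set $\Delta s_i=sign\cdot\mu$ and break; otherwise set $\Delta s_i=sign\cdot cost$ and $\mu=\mu-cost$.
   Formalization: In Algorithm 1 the largest |g_i| is sought only among components not yet treated, and the loop ends when all are treated; read literally the same component would be selected every time and the output could be non-optimal or the loop endless. The budget is assumed nonnegative. *)

theory Defs
  imports "HOL-Analysis.Analysis"
begin

text \<open>
  The vertex set is the universe of a finite type \<open>'n\<close>, so $|V|$ is \<open>CARD('n)\<close>. The weight
  function \<open>w\<close> matters only on the edge set \<open>E\<close>. Self-loops are not excluded.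
\<close>

definition social_trust_network :: "('n::finite \<times> 'n) set \<Rightarrow> ('n \<Rightarrow> 'n \<Rightarrow> real) \<Rightarrow> bool" where
  "social_trust_network E w \<longleftrightarrow> (\<forall>(i, j)\<in>E. -1 \<le> w i j \<and> w i j \<le> 1)"

definition adj_matrix :: "('n::finite \<times> 'n) set \<Rightarrow> ('n \<Rightarrow> 'n \<Rightarrow> real) \<Rightarrow> real^'n^'n" where
  "adj_matrix E w = (\<chi> i j. if (i, j) \<in> E then w i j else 0)"

definition abs_degree_matrix :: "('n::finite \<times> 'n) set \<Rightarrow> ('n \<Rightarrow> 'n \<Rightarrow> real) \<Rightarrow> real^'n^'n" where
  "abs_degree_matrix E w =
     (\<chi> i j. if i = j then (\<Sum>k\<in>UNIV. \<bar>adj_matrix E w $ i $ k\<bar>) else 0)"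

definition signed_laplacian :: "('n::finite \<times> 'n) set \<Rightarrow> ('n \<Rightarrow> 'n \<Rightarrow> real) \<Rightarrow> real^'n^'n" where
  "signed_laplacian E w = abs_degree_matrix E w - adj_matrix E w"

text \<open>
  The next lemma shows that \<open>matrix_inv\<close> is only ever applied to an invertible matrix below:
  $\bar L + I$ is strictly diagonally dominant.
\<close>

lemma invertible_signed_laplacian_plus_id:
  "invertible (signed_laplacian E w + mat 1)"
proof -
  let ?A = "adj_matrix E w"
  have "x = 0" if eq: "(signed_laplacian E w + mat 1) *v x = 0" for x
  proof -
    have row: "(\<Sum>k\<in>UNIV. \<bar>?A $ i $ k\<bar>) * x $ i + x $ i = (\<Sum>j\<in>UNIV. ?A $ i $ j * x $ j)" for i
    proof -
      have "0 = ((signed_laplacian E w + mat 1) *v x) $ i"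
        using eq by simp
      also have "\<dots> = (\<Sum>j\<in>UNIV. (if i = j then (\<Sum>k\<in>UNIV. \<bar>?A $ i $ k\<bar>) * x $ j + x $ j else 0)
          - ?A $ i $ j * x $ j)"
        by (auto simp: matrix_vector_mult_def signed_laplacian_def abs_degree_matrix_def mat_def
            algebra_simps intro!: sum.cong)
      also have "\<dots> = (\<Sum>k\<in>UNIV. \<bar>?A $ i $ k\<bar>) * x $ i + x $ i - (\<Sum>j\<in>UNIV. ?A $ i $ j * x $ j)"
        by (simp add: sum_subtractf)
      finally show ?thesis by simp
    qed
    obtain i where i: "\<bar>x $ j\<bar> \<le> \<bar>x $ i\<bar>" for j
    proof -
      have "Max (range (\<lambda>j. \<bar>x $ j\<bar>)) \<in> range (\<lambda>j. \<bar>x $ j\<bar>)"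
        by (rule Max_in) auto
      then obtain i where "Max (range (\<lambda>j. \<bar>x $ j\<bar>)) = \<bar>x $ i\<bar>" by (rule rangeE)
      then have "\<bar>x $ j\<bar> \<le> \<bar>x $ i\<bar>" for j
        by (metis Max_ge finite finite_imageI rangeI)
      then show ?thesis by (rule that)
    qed
    define S where "S = (\<Sum>k\<in>UNIV. \<bar>?A $ i $ k\<bar>)"
    have S0: "S \<ge> 0" by (simp add: S_def sum_nonneg)
    have "(S + 1) * \<bar>x $ i\<bar> = \<bar>S * x $ i + x $ i\<bar>"
      using S0 by (simp add: abs_mult flip: distrib_right[of S 1, simplified])
    also have "\<dots> = \<bar>\<Sum>j\<in>UNIV. ?A $ i $ j * x $ j\<bar>"
      using row[of i] by (simp add: S_def)
    also have "\<dots> \<le> (\<Sum>j\<in>UNIV. \<bar>?A $ i $ j\<bar> * \<bar>x $ i\<bar>)"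
      by (rule order_trans[OF sum_abs]) (auto simp: abs_mult intro!: sum_mono mult_left_mono i)
    also have "\<dots> = S * \<bar>x $ i\<bar>"
      by (simp add: S_def sum_distrib_right)
    finally have "\<bar>x $ i\<bar> \<le> 0" by (simp add: algebra_simps)
    with i have "x $ j = 0" for j
      by (metis abs_le_zero_iff order_trans)
    then show ?thesis by (simp add: vec_eq_iff)
  qed
  then show ?thesis
    by (metis invertible_left_inverse matrix_left_invertible_ker)
qed

definition contribution_index :: "('n::finite \<times> 'n) set \<Rightarrow> ('n \<Rightarrow> 'n \<Rightarrow> real) \<Rightarrow> real^'n" where
  "contribution_index E w = vec 1 v* matrix_inv (signed_laplacian E w + mat 1)"


section \<open>The Internal Opinion Problem\<close>

definition l1_norm :: "real^'n::finite \<Rightarrow> real" where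
  "l1_norm x = (\<Sum>i\<in>UNIV. \<bar>x $ i\<bar>)"

definition iop_objective ::
    "('n::finite \<times> 'n) set \<Rightarrow> ('n \<Rightarrow> 'n \<Rightarrow> real) \<Rightarrow> real^'n \<Rightarrow> real^'n \<Rightarrow> real" where
  "iop_objective E w s ds = vec 1 \<bullet> (matrix_inv (signed_laplacian E w + mat 1) *v (s + ds))"

definition iop_feasible :: "real^'n::finite \<Rightarrow> real \<Rightarrow> real^'n \<Rightarrow> bool" where
  "iop_feasible s \<mu> ds \<longleftrightarrow>
     (\<forall>i. -1 \<le> s $ i + ds $ i \<and> s $ i + ds $ i \<le> 1) \<and> l1_norm ds \<le> \<mu>"

definition iop_optimal ::
    "('n::finite \<times> 'n) set \<Rightarrow> ('n \<Rightarrow> 'n \<Rightarrow> real) \<Rightarrow> real^'n \<Rightarrow> real \<Rightarrow> real^'n \<Rightarrow> bool" where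
  "iop_optimal E w s \<mu> ds \<longleftrightarrow> is_arg_max (iop_objective E w s) (iop_feasible s \<mu>) ds"


section \<open>The greedy algorithm\<close>

text \<open>
  A state \<open>Running P \<mu> ds\<close> is the head of the while loop, with remaining budget \<open>\<mu>\<close>, current
  modification \<open>ds\<close> and set \<open>P\<close> of components already treated; \<open>Halted ds\<close> means that the loop
  has been left with output \<open>ds\<close>. The largest component of \<open>g\<close> is sought among the components
  outside \<open>P\<close>: each component is treated at most once, since a search over all components would
  select the same one in every iteration. Ties are broken arbitrarily, so a step is a relation.
\<close>

datatype 'n alg_state = Running "'n set" real "real^'n" | Halted "real^'n"

definition largest_untreated :: "real^'n \<Rightarrow> 'n::finite set \<Rightarrow> 'n \<Rightarrow> bool" where
  "largest_untreated g P i \<longleftrightarrow> i \<notin> P \<and> (\<forall>j. j \<notin> P \<longrightarrow> \<bar>g $ j\<bar> \<le> \<bar>g $ i\<bar>)"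

definition set_component :: "real^'n \<Rightarrow> 'n::finite \<Rightarrow> real \<Rightarrow> real^'n" where
  "set_component x i c = (\<chi> j. if j = i then c else x $ j)"

inductive alg_step :: "real^'n \<Rightarrow> real^'n \<Rightarrow> 'n::finite alg_state \<Rightarrow> 'n alg_state \<Rightarrow> bool"
  for g s :: "real^'n::finite" where
  no_budget: "\<not> \<mu> > 0 \<Longrightarrow> alg_step g s (Running P \<mu> ds) (Halted ds)"
| all_treated: "\<mu> > 0 \<Longrightarrow> P = UNIV \<Longrightarrow> alg_step g s (Running P \<mu> ds) (Halted ds)"
| zero_index:
    "\<mu> > 0 \<Longrightarrow> largest_untreated g P i \<Longrightarrow> g $ i = 0
     \<Longrightarrow> alg_step g s (Running P \<mu> ds) (Halted ds)"
| partial: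
    "\<mu> > 0 \<Longrightarrow> largest_untreated g P i \<Longrightarrow> g $ i \<noteq> 0
     \<Longrightarrow> sgn_i = g $ i / \<bar>g $ i\<bar> \<Longrightarrow> cost = 1 - sgn_i * s $ i \<Longrightarrow> cost > \<mu>
     \<Longrightarrow> alg_step g s (Running P \<mu> ds) (Halted (set_component ds i (sgn_i * \<mu>)))"
| full:
    "\<mu> > 0 \<Longrightarrow> largest_untreated g P i \<Longrightarrow> g $ i \<noteq> 0
     \<Longrightarrow> sgn_i = g $ i / \<bar>g $ i\<bar> \<Longrightarrow> cost = 1 - sgn_i * s $ i \<Longrightarrow> \<not> cost > \<mu>
     \<Longrightarrow> alg_step g s (Running P \<mu> ds)
           (Running (insert i P) (\<mu> - cost) (set_component ds i (sgn_i * cost)))"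

definition alg_terminates ::
    "('n::finite \<times> 'n) set \<Rightarrow> ('n \<Rightarrow> 'n \<Rightarrow> real) \<Rightarrow> real^'n \<Rightarrow> real \<Rightarrow> bool" where
  "alg_terminates E w s \<mu> \<longleftrightarrow>
     (\<nexists>\<sigma> :: nat \<Rightarrow> 'n alg_state.
        \<sigma> 0 = Running {} \<mu> 0 \<and>
        (\<forall>k. alg_step (contribution_index E w) s (\<sigma> k) (\<sigma> (Suc k))))"

definition alg_outputs ::
    "('n::finite \<times> 'n) set \<Rightarrow> ('n \<Rightarrow> 'n \<Rightarrow> real) \<Rightarrow> real^'n \<Rightarrow> real \<Rightarrow> real^'n \<Rightarrow> bool" where
  "alg_outputs E w s \<mu> ds \<longleftrightarrow>
     (alg_step (contribution_index E w) s)\<^sup>*\<^sup>* (Running {} \<mu> 0) (Halted ds)"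

end

(* A modification ds is optimal if, for some Lagrange multiplier l of the budget constraint, every
   component ds_i maximizes g_i x - l |x| over the box -1 <= s_i + x <= 1 and complementary slackness
   holds. In the greedy output the components with |g_i| > l are pushed to the boundary and those with
   |g_i| < l are left untouched, where l is the value |g_i| at which the budget runs out (0 if it does
   not), so that l is such a multiplier. *)
theory Submission
  imports Defs
begin

section \<open>Lagrangian bounds for a linear objective\<close>

lemma iop_objective_eq_inner:
  "iop_objective E w s ds = contribution_index E w \<bullet> (s + ds)"
  by (simp add: iop_objective_def contribution_index_def dot_lmul_matrix)

lemma lagrange_multiplier_optimal:
  fixes g s d y :: "real^'n::finite"
  assumes "0 \<le> l" and slack: "l * (\<mu> - l1_norm d) = 0"
    and comp: "\<And>i x. -1 \<le> s $ i + x \<Longrightarrow> s $ i + x \<le> 1 \<Longrightarrow>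
                 g $ i * x - l * \<bar>x\<bar> \<le> g $ i * d $ i - l * \<bar>d $ i\<bar>"
    and y: "iop_feasible s \<mu> y"
  shows "g \<bullet> y \<le> g \<bullet> d"
proof -
  have "(\<Sum>i\<in>UNIV. g $ i * y $ i - l * \<bar>y $ i\<bar>) \<le> (\<Sum>i\<in>UNIV. g $ i * d $ i - l * \<bar>d $ i\<bar>)"
    using y by (intro sum_mono comp) (auto simp: iop_feasible_def)
  then have "g \<bullet> y - l * l1_norm y \<le> g \<bullet> d - l * l1_norm d"
    by (simp add: inner_vec_def l1_norm_def sum_subtractf sum_distrib_left)
  moreover have "l * l1_norm y \<le> l * \<mu>"
    using y \<open>0 \<le> l\<close> by (intro mult_left_mono) (auto simp: iop_feasible_def)
  moreover have "l * \<mu> = l * l1_norm d"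
    using slack by (simp add: right_diff_distrib)
  ultimately show ?thesis by linarith
qed

text \<open>Put \<open>z = sgn a * x\<close>, the displacement in the direction of \<open>a\<close>.
  The left side is at most \<open>(\<bar>a\<bar> - l) * z\<close>, which is nondecreasing in
  \<open>z\<close>, and the box allows \<open>z\<close> to reach
  \<open>1 - sgn a * t\<close>.\<close>

lemma lagrangian_le_boundary:
  fixes a t l x :: real
  assumes "a \<noteq> 0" "0 \<le> l" "l \<le> \<bar>a\<bar>" "-1 \<le> t" "t \<le> 1" "-1 \<le> t + x" "t + x \<le> 1"
  shows "a * x - l * \<bar>x\<bar> \<le> a * (sgn a * (1 - sgn a * t)) - l * \<bar>sgn a * (1 - sgn a * t)\<bar>"
proof -
  have c: "sgn a * x \<le> 1 - sgn a * t" "0 \<le> 1 - sgn a * t" "\<bar>sgn a\<bar> = 1"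
    using assms by (auto simp: sgn_if)
  have "a * x = \<bar>a\<bar> * (sgn a * x)"
    by (simp add: sgn_if)
  moreover have "l * (sgn a * x) \<le> l * \<bar>x\<bar>"
    using \<open>0 \<le> l\<close> by (intro mult_left_mono) (auto simp: sgn_if)
  moreover have "(\<bar>a\<bar> - l) * (sgn a * x) \<le> (\<bar>a\<bar> - l) * (1 - sgn a * t)"
    using c assms by (intro mult_left_mono) auto
  moreover have "a * (sgn a * (1 - sgn a * t)) = \<bar>a\<bar> * (1 - sgn a * t)"
    by (simp add: abs_sgn mult.assoc)
  moreover have "\<bar>sgn a * (1 - sgn a * t)\<bar> = 1 - sgn a * t"
    using c(2,3) by (simp add: abs_mult del: abs_sgn_eq)
  ultimately show ?thesis
    by (simp only: left_diff_distrib)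
qed

lemma lagrangian_le_zero:
  fixes a l x :: real
  assumes "\<bar>a\<bar> \<le> l"
  shows "a * x - l * \<bar>x\<bar> \<le> 0"
proof -
  have "a * x \<le> \<bar>a\<bar> * \<bar>x\<bar>"
    by (metis abs_ge_self abs_mult)
  also have "\<dots> \<le> l * \<bar>x\<bar>"
    using assms by (rule mult_right_mono) simp
  finally show ?thesis by simp
qed

section \<open>Greedy states and optimality of the outputs\<close>

lemma l1_norm_set_component:
  assumes "x $ i = 0"
  shows "l1_norm (set_component x i c) = l1_norm x + \<bar>c\<bar>"
  using assms by (simp add: l1_norm_def set_component_def sum.remove[of UNIV i])

text \<open>The loop invariant, with \<open>m\<close> the remaining budget. Its last clause makes
  \<open>P\<close> a top segment in the order of \<open>\<bar>g $ i\<bar>\<close>, so that one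
  threshold can separate \<open>P\<close> from its complement. The norm is an equation so that
  slackness becomes \<open>l * m = 0\<close>.\<close>

definition greedy_state :: "real^'n \<Rightarrow> real^'n \<Rightarrow> real \<Rightarrow> 'n::finite set \<Rightarrow> real \<Rightarrow> real^'n \<Rightarrow> bool" where
  "greedy_state g s \<mu> P m d \<longleftrightarrow>
     0 \<le> m \<and> l1_norm d = \<mu> - m \<and>
     (\<forall>i\<in>P. g $ i \<noteq> 0 \<and> d $ i = sgn (g $ i) * (1 - sgn (g $ i) * s $ i)) \<and>
     (\<forall>i. i \<notin> P \<longrightarrow> d $ i = 0) \<and>
     (\<forall>i j. i \<in> P \<longrightarrow> j \<notin> P \<longrightarrow> \<bar>g $ j\<bar> \<le> \<bar>g $ i\<bar>)"

text \<open>The objective differs from this inner product only by the constant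
  \<open>g \<bullet> s\<close>, which does not affect comparisons.\<close>

definition linear_optimal :: "real^'n \<Rightarrow> real^'n \<Rightarrow> real \<Rightarrow> real^'n::finite \<Rightarrow> bool" where
  "linear_optimal g s \<mu> d \<longleftrightarrow> iop_feasible s \<mu> d \<and> (\<forall>y. iop_feasible s \<mu> y \<longrightarrow> g \<bullet> y \<le> g \<bullet> d)"

text \<open>Handles every exit that returns the current \<open>d\<close>: a threshold
  \<open>l\<close> between the treated and the untreated values serves as multiplier.\<close>

lemma linear_optimalI:
  assumes box: "\<And>i. -1 \<le> s $ i \<and> s $ i \<le> 1"
    and st: "greedy_state g s \<mu> P m d"
    and "0 \<le> l" "l * m = 0"
    and "\<And>i. i \<in> P \<Longrightarrow> l \<le> \<bar>g $ i\<bar>" "\<And>i. i \<notin> P \<Longrightarrow> \<bar>g $ i\<bar> \<le> l"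
  shows "linear_optimal g s \<mu> d"
proof -
  have "iop_feasible s \<mu> d"
    unfolding iop_feasible_def
  proof (intro conjI allI)
    fix i
    have "s $ i + d $ i \<in> {-1..1}"
      using st box[of i] by (cases "i \<in> P") (auto simp: greedy_state_def sgn_if)
    then show "-1 \<le> s $ i + d $ i" "s $ i + d $ i \<le> 1" by auto
  next
    show "l1_norm d \<le> \<mu>"
      using st by (simp add: greedy_state_def)
  qed
  moreover have "g $ i * x - l * \<bar>x\<bar> \<le> g $ i * d $ i - l * \<bar>d $ i\<bar>"
    if "-1 \<le> s $ i + x" "s $ i + x \<le> 1" for i x
  proof (cases "i \<in> P")
    case True
    then show ?thesis
      using st lagrangian_le_boundary[of "g $ i" l "s $ i" x] assms box[of i] that
      by (simp add: greedy_state_def)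
  next
    case False
    then show ?thesis
      using st lagrangian_le_zero[of "g $ i" l x] assms by (simp add: greedy_state_def)
  qed
  moreover have "l * (\<mu> - l1_norm d) = 0"
    using st \<open>l * m = 0\<close> by (simp add: greedy_state_def)
  ultimately show ?thesis
    using \<open>0 \<le> l\<close> unfolding linear_optimal_def
    by (auto intro!: lagrange_multiplier_optimal[where l = l])
qed

text \<open>The partial step spends the whole remaining budget, so slackness holds for every
  multiplier, in particular for \<open>\<bar>g $ i\<bar>\<close>.\<close>

lemma linear_optimal_partial:
  assumes box: "\<And>i. -1 \<le> s $ i \<and> s $ i \<le> 1"
    and st: "greedy_state g s \<mu> P m d"
    and i: "largest_untreated g P i" "g $ i \<noteq> 0" "1 - sgn (g $ i) * s $ i > m"
  shows "linear_optimal g s \<mu> (set_component d i (sgn (g $ i) * m))"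
    (is "linear_optimal g s \<mu> ?d")
proof -
  have iP: "i \<notin> P" and max: "\<And>j. j \<notin> P \<Longrightarrow> \<bar>g $ j\<bar> \<le> \<bar>g $ i\<bar>"
    using i by (auto simp: largest_untreated_def)
  have m: "0 \<le> m" and di: "d $ i = 0"
    using st iP by (auto simp: greedy_state_def)
  have "\<bar>sgn (g $ i)\<bar> = 1" using i by (simp add: sgn_if)
  then have l1: "l1_norm ?d = \<mu>"
    using st m di by (simp add: l1_norm_set_component abs_mult greedy_state_def)
  have "iop_feasible s \<mu> ?d"
    unfolding iop_feasible_def
  proof (intro conjI allI)
    fix j
    have "s $ j + ?d $ j \<in> {-1..1}"
    proof (cases "j = i")
      case True
      then show ?thesis
        using i m box[of i] by (auto simp: set_component_def sgn_if split: if_splits)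
    next
      case False
      then show ?thesis
        using st box[of j]
        by (cases "j \<in> P") (auto simp: greedy_state_def set_component_def sgn_if)
    qed
    then show "-1 \<le> s $ j + ?d $ j" "s $ j + ?d $ j \<le> 1" by auto
  next
    show "l1_norm ?d \<le> \<mu>" using l1 by simp
  qed
  moreover have "g $ j * x - \<bar>g $ i\<bar> * \<bar>x\<bar> \<le> g $ j * ?d $ j - \<bar>g $ i\<bar> * \<bar>?d $ j\<bar>"
    if "-1 \<le> s $ j + x" "s $ j + x \<le> 1" for j x
  proof (cases "j \<in> P")
    case True
    moreover from True have "j \<noteq> i" using iP by auto
    ultimately show ?thesis
      using st lagrangian_le_boundary[of "g $ j" "\<bar>g $ i\<bar>" "s $ j" x] iP box[of j] that
      by (simp add: greedy_state_def set_component_def)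
  next
    case False
    \<comment> \<open>For \<open>j = i\<close> gain and penalty are both
      \<open>\<bar>g $ i\<bar> * m\<close> and cancel; every other untreated component is still
      0.\<close>
    have "g $ j * ?d $ j - \<bar>g $ i\<bar> * \<bar>?d $ j\<bar> = 0"
      using st False m by (auto simp: greedy_state_def set_component_def sgn_if)
    then show ?thesis
      using lagrangian_le_zero[OF max[OF False], of x] by simp
  qed
  ultimately show ?thesis
    using l1 unfolding linear_optimal_def
    by (auto intro!: lagrange_multiplier_optimal[where l = "\<bar>g $ i\<bar>"])
qed

lemma largest_untreated_exists:
  fixes P :: "'n::finite set"
  assumes "P \<noteq> UNIV"
  obtains i where "largest_untreated g P i"
proof -
  let ?M = "Max ((\<lambda>j. \<bar>g $ j\<bar>) ` (- P))"
  have "?M \<in> (\<lambda>j. \<bar>g $ j\<bar>) ` (- P)"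
    using assms by (intro Max_in) auto
  then obtain i where "i \<notin> P" "?M = \<bar>g $ i\<bar>" by auto
  moreover have "\<bar>g $ j\<bar> \<le> ?M" if "j \<notin> P" for j
    using that by (intro Max_ge) auto
  ultimately show ?thesis
    by (intro that[of i]) (auto simp: largest_untreated_def)
qed

text \<open>Since \<open>i\<close> is maximal outside \<open>P\<close>, adding it keeps a top
  segment; since \<open>d $ i = 0\<close> before the step, the norm grows by exactly
  \<open>c\<close>.\<close>

lemma greedy_state_full:
  assumes box: "\<And>i. -1 \<le> s $ i \<and> s $ i \<le> 1"
    and st: "greedy_state g s \<mu> P m d"
    and i: "largest_untreated g P i" "g $ i \<noteq> 0"
    and c: "c = 1 - sgn (g $ i) * s $ i" "c \<le> m"
  shows "greedy_state g s \<mu> (insert i P) (m - c) (set_component d i (sgn (g $ i) * c))"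
proof -
  have iP: "i \<notin> P" using i by (simp add: largest_untreated_def)
  have "0 \<le> c" using box[of i] c by (auto simp: sgn_if)
  moreover have "\<bar>sgn (g $ i)\<bar> = 1" using i by (simp add: sgn_if)
  ultimately have "l1_norm (set_component d i (sgn (g $ i) * c)) = l1_norm d + c"
    using st iP by (simp add: l1_norm_set_component greedy_state_def abs_mult)
  then show ?thesis
    using st i c iP by (auto simp: greedy_state_def largest_untreated_def set_component_def)
qed

section \<open>Preservation along a run\<close>

fun alg_invariant :: "real^'n \<Rightarrow> real^'n \<Rightarrow> real \<Rightarrow> 'n::finite alg_state \<Rightarrow> bool" where
  "alg_invariant g s \<mu> (Running P m d) \<longleftrightarrow> greedy_state g s \<mu> P m d"
| "alg_invariant g s \<mu> (Halted d) \<longleftrightarrow> linear_optimal g s \<mu> d"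

lemma alg_invariant_step:
  assumes "alg_step g s a b" and box: "\<And>i. -1 \<le> s $ i \<and> s $ i \<le> 1"
    and "alg_invariant g s \<mu> a"
  shows "alg_invariant g s \<mu> b"
  using assms(1,3)
proof cases
  case (no_budget m P d)
  with assms have st: "greedy_state g s \<mu> P m d" by simp
  with no_budget have m: "m = 0" by (simp add: greedy_state_def)
  \<comment> \<open>With \<open>m = 0\<close> slackness is automatic, so any threshold works: 0 if
    nothing is untreated, otherwise the largest untreated value.\<close>
  have "linear_optimal g s \<mu> d"
  proof (cases "P = UNIV")
    case True
    then show ?thesis by (intro linear_optimalI[OF box st, of 0]) auto
  next
    case False
    then obtain i where "largest_untreated g P i" by (rule largest_untreated_exists)
    then show ?thesis
      using st m by (intro linear_optimalI[OF box st, of "\<bar>g $ i\<bar>"])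
        (auto simp: largest_untreated_def greedy_state_def)
  qed
  with no_budget show ?thesis by simp
next
  case (all_treated m P d)
  with assms have st: "greedy_state g s \<mu> P m d" by simp
  have "linear_optimal g s \<mu> d"
    \<comment> \<open>As \<open>m > 0\<close>, slackness forces the multiplier 0, a valid threshold
      because no index is untreated.\<close>
    using all_treated by (intro linear_optimalI[OF box st, of 0]) auto
  with all_treated show ?thesis by simp
next
  case (zero_index m P i d)
  with assms have st: "greedy_state g s \<mu> P m d" by simp
  have "linear_optimal g s \<mu> d"
    \<comment> \<open>Again the multiplier is 0: the largest untreated value vanishes, hence all of
      them do.\<close>
    using zero_index by (intro linear_optimalI[OF box st, of 0]) (auto simp: largest_untreated_def)
  with zero_index show ?thesis by simp
next
  case (partial m P i sgn_i cost d)
  with assms show ?thesis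
    using linear_optimal_partial[of s g \<mu> P m d i] by (simp add: real_sgn_eq)
next
  case (full m P i sgn_i cost d)
  with assms show ?thesis
    using greedy_state_full[of s g \<mu> P m d i cost] by (simp add: real_sgn_eq)
qed

section \<open>Termination and existence of an output\<close>

text \<open>The \<open>Suc\<close> makes halting a strict decrease even when
  \<open>P = UNIV\<close>.\<close>

fun alg_measure :: "'n::finite alg_state \<Rightarrow> nat" where
  "alg_measure (Running P m d) = Suc (card (- P))"
| "alg_measure (Halted d) = 0"

lemma alg_step_decreases: "alg_step g s a b \<Longrightarrow> alg_measure b < alg_measure a"
  by (induction rule: alg_step.induct)
    (auto simp: largest_untreated_def intro!: psubset_card_mono)

lemma alg_step_progress: "\<exists>b. alg_step g s (Running P m d) b"
proof (cases "m > 0 \<and> P \<noteq> UNIV")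
  case True
  then obtain i where "largest_untreated g P i" by (metis largest_untreated_exists)
  with True show ?thesis
    by (metis alg_step.zero_index alg_step.partial alg_step.full)
next
  case False
  then show ?thesis by (metis alg_step.no_budget alg_step.all_treated)
qed

text \<open>A \<open>Running\<close> state always has a successor and the measure drops, so some run
  halts; this keeps the optimality claim about outputs from being vacuous.\<close>

lemma alg_reaches_Halted: "\<exists>d. (alg_step g s)\<^sup>*\<^sup>* a (Halted d)"
proof (induction "alg_measure a" arbitrary: a rule: less_induct)
  case less
  show ?case
  proof (cases a)
    case (Running P m d)
    then obtain b where b: "alg_step g s a b" using alg_step_progress by metis
    with less[OF alg_step_decreases[OF b]] show ?thesis
      by (metis converse_rtranclp_into_rtranclp)
  qed auto
qed

lemma no_infinite_alg_run: "\<nexists>\<sigma>. \<forall>k. alg_step g s (\<sigma> k) (\<sigma> (Suc k))"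
proof
  assume "\<exists>\<sigma>. \<forall>k. alg_step g s (\<sigma> k) (\<sigma> (Suc k))"
  then obtain \<sigma> where "\<And>k. alg_step g s (\<sigma> k) (\<sigma> (Suc k))" by blast
  then have "\<forall>k. (\<sigma> (Suc k), \<sigma> k) \<in> inv_image less_than alg_measure"
    by (auto intro: alg_step_decreases)
  moreover have "wf (inv_image less_than alg_measure)" by simp
  ultimately show False
    unfolding wf_iff_no_infinite_down_chain by blast
qed

theorem theorem2:
  fixes E :: "('n::finite \<times> 'n) set"
    and w :: "'n \<Rightarrow> 'n \<Rightarrow> real"
    and s :: "real^'n"
    and \<mu> :: real
  assumes "social_trust_network E w"
    and "\<And>i. -1 \<le> s $ i \<and> s $ i \<le> 1"
    and "0 \<le> \<mu>"
  shows "alg_terminates E w s \<mu> \<and>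
         (\<exists>ds. alg_outputs E w s \<mu> ds) \<and>
         (\<forall>ds. alg_outputs E w s \<mu> ds \<longrightarrow> iop_optimal E w s \<mu> ds)"
proof (intro conjI allI impI)
  show "alg_terminates E w s \<mu>"
    using no_infinite_alg_run unfolding alg_terminates_def by blast
  show "\<exists>ds. alg_outputs E w s \<mu> ds"
    unfolding alg_outputs_def by (rule alg_reaches_Halted)
next
  fix ds
  let ?g = "contribution_index E w"
  assume "alg_outputs E w s \<mu> ds"
  then have "(alg_step ?g s)\<^sup>*\<^sup>* (Running {} \<mu> 0) (Halted ds)"
    by (simp add: alg_outputs_def)
  \<comment> \<open>Initially nothing is treated or spent, so the invariant reduces to
    \<open>0 \<le> \<mu>\<close>.\<close>
  moreover have "alg_invariant ?g s \<mu> (Running {} \<mu> 0)"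
    using assms(3) by (simp add: greedy_state_def l1_norm_def)
  ultimately have "alg_invariant ?g s \<mu> (Halted ds)"
    by (induction rule: rtranclp_induct) (auto intro: alg_invariant_step[OF _ assms(2)])
  then show "iop_optimal E w s \<mu> ds"
    by (auto simp: iop_optimal_def is_arg_max_linorder linear_optimal_def iop_objective_eq_inner
        inner_add_right)
qed

end
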